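(* Let $\Sigma$ be a finite state set, let $\mathcal{R}$ be a finite set of local rules with state set $\Sigma$ and a common neighbourhood $N$ in $\mathbb{Z}$, and let $\theta \in \mathcal{R}^{\mathbb{Z}}$ be a recurrent rule distribution. Then the global update rule $H_\theta : \Sigma^{\mathbb{Z}} \to \Sigma^{\mathbb{Z}}$ is surjective if and only if it is pre-injective.
   Context: A neighbourhood is a tuple $N = (n_1,\ldots,n_m)$ of integers. A local rule with state set $\Sigma$ and neighbourhood $N$ is a function $f:\Sigma^m \to \Sigma$. A configuration over a finite set $S$ is a function $c:\mathbb{Z} \to S$. A (local) rule distribution is a configuration $\theta \in \mathcal{R}^{\mathbb{Z}}$, where $\mathcal{R}$ is a finite set of local rules with the same state set $\Sigma$ and neighbourhood $N$. It defines a non-uniform cellular automaton (NUCA) with global update rule $H_\theta:\Sigma^{\mathbb{Z}}\to\Sigma^{\mathbb{Z}}$, $$H_\theta(c)(x) = \theta(x)\big(c(x+n_1),\ldots,c(x+n_m)\big)\quad\text{for all } x \in \mathbb{Z}.$$ Two configurations $c,e\in\Sigma^{\mathbb{Z}}$ are asymptotic if $\{x : c(x)\neq e(x)\}$ is finite. $H_\theta$ is pre-injective if $H_\theta(c)\neq H_\theta(e)$ for all asymptotic $c,e$ with $c \neq e$. A configuration $c$ is recurrent if every finite pattern that appears in it appears at least twice: for every nonempty finite $D\subseteq\mathbb{Z}$ there is $r\in\mathbb{Z}$, $r\neq 0$, such that $c(x+r)=c(x)$ for all $x\in D$. *)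

theory Defs
  imports Main "HOL-Library.FuncSet"
begin

type_synonym neighbourhood = "int list"

definition configurations :: "'s set \<Rightarrow> (int \<Rightarrow> 's) set" where
  "configurations S = UNIV \<rightarrow> S"

text \<open>Tuples over the state set are lists of the appropriate length. Local rules are
  extensional functions, so that equality of rules, on which recurrence of a rule distribution
  depends, is equality as functions on tuples of states.\<close>

definition tuples :: "'a set \<Rightarrow> nat \<Rightarrow> 'a list set" where
  "tuples \<Sigma> m = {xs. set xs \<subseteq> \<Sigma> \<and> length xs = m}"

definition local_rules :: "'a set \<Rightarrow> neighbourhood \<Rightarrow> ('a list \<Rightarrow> 'a) set" where
  "local_rules \<Sigma> N = tuples \<Sigma> (length N) \<rightarrow>\<^sub>E \<Sigma>"

definition global_update ::
  "neighbourhood \<Rightarrow> (int \<Rightarrow> 'a list \<Rightarrow> 'a) \<Rightarrow> (int \<Rightarrow> 'a) \<Rightarrow> (int \<Rightarrow> 'a)" where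
  "global_update N \<theta> c x = \<theta> x (map (\<lambda>n. c (x + n)) N)"

definition asymptotic :: "(int \<Rightarrow> 's) \<Rightarrow> (int \<Rightarrow> 's) \<Rightarrow> bool" where
  "asymptotic c e \<longleftrightarrow> finite {x. c x \<noteq> e x}"

definition pre_injective_on :: "(int \<Rightarrow> 'a) set \<Rightarrow> ((int \<Rightarrow> 'a) \<Rightarrow> (int \<Rightarrow> 'a)) \<Rightarrow> bool" where
  "pre_injective_on C H \<longleftrightarrow>
     (\<forall>c\<in>C. \<forall>e\<in>C. asymptotic c e \<and> c \<noteq> e \<longrightarrow> H c \<noteq> H e)"

definition recurrent :: "(int \<Rightarrow> 's) \<Rightarrow> bool" where
  "recurrent c \<longleftrightarrow>
     (\<forall>D. finite D \<and> D \<noteq> {} \<longrightarrow> (\<exists>r. r \<noteq> 0 \<and> (\<forall>x\<in>D. c (x + r) = c x)))"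

lemma global_update_configurations:
  assumes "\<R> \<subseteq> local_rules \<Sigma> N" and "\<theta> \<in> configurations \<R>" and "c \<in> configurations \<Sigma>"
  shows "global_update N \<theta> c \<in> configurations \<Sigma>"
  using assms by (fastforce simp: configurations_def local_rules_def tuples_def global_update_def)

end

theory Submission
  imports Defs Complex_Main "HOL-Library.Disjoint_Sets" "HOL-Library.Infinite_Set"
begin

text \<open>Recurrence places arbitrarily many disjoint copies of any finite pattern of local rules
  inside an interval. If some pattern of states can be avoided on all these copies, an exponentially
  small fraction of the patterns on the interval remains. The boundary of an interval has bounded
  size, so this factor wins although the density of the copies may be zero. Pairs of mutually
  erasable patterns thus contradict surjectivity and, by compactness, a missing image contradicts
  pre-injectivity.\<close>

section \<open>Counting patterns that avoid a prescribed pattern on disjoint sets of cells\<close>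

definition avoiding :: "'x set \<Rightarrow> 's set \<Rightarrow> 'i set \<Rightarrow> ('i \<Rightarrow> 'x set) \<Rightarrow> ('i \<Rightarrow> 'x \<Rightarrow> 's) \<Rightarrow> ('x \<Rightarrow> 's) set"
  where "avoiding I S R D p = {c \<in> I \<rightarrow>\<^sub>E S. \<forall>r\<in>R. \<exists>x\<in>D r. c x \<noteq> p r x}"

lemma configurations_iff: "c \<in> configurations S \<longleftrightarrow> (\<forall>x. c x \<in> S)"
  by (auto simp: configurations_def)

lemma finite_avoiding: "finite I \<Longrightarrow> finite S \<Longrightarrow> finite (avoiding I S R D p)"
  by (simp add: avoiding_def finite_PiE)

text \<open>Each set \<open>D r\<close> allows all but one of its \<open>card S ^ d\<close>
  patterns, and disjointness makes these restrictions independent. The induction removes one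
  \<open>D r\<close> at a time from \<open>I\<close>, so \<open>I\<close> must vary. The powers
  stand on both sides to avoid division.\<close>

lemma card_avoiding_le:
  assumes "finite R" "finite S" "finite I" "disjoint_family_on D R"
    and "\<And>r. r \<in> R \<Longrightarrow> D r \<subseteq> I \<and> card (D r) = d \<and> p r ` D r \<subseteq> S"
  shows "card (avoiding I S R D p) * (card S ^ d) ^ card R \<le> card S ^ card I * (card S ^ d - 1) ^ card R"
  using assms
proof (induction R arbitrary: I rule: finite_induct)
  case empty
  then show ?case by (simp add: avoiding_def card_PiE)
next
  case (insert r R)
  let ?J = "I - D r" and ?s = "card S"
  let ?F = "\<lambda>c. (restrict c ?J, restrict c (D r))"
  let ?Q = "(D r \<rightarrow>\<^sub>E S) - {restrict (p r) (D r)}"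
  have r: "D r \<subseteq> I" "card (D r) = d" "p r ` D r \<subseteq> S"
    using insert.prems(4)[of r] by auto
  have finD: "finite (D r)" using r(1) insert.prems(2) finite_subset by blast
  have disj: "D r' \<inter> D r = {}" if "r' \<in> R" for r'
    using insert.prems(3) insert.hyps(2) that by (auto simp: disjoint_family_on_def)
  have IH: "card (avoiding ?J S R D p) * (?s ^ d) ^ card R \<le> ?s ^ card ?J * (?s ^ d - 1) ^ card R"
  proof (rule insert.IH)
    show "disjoint_family_on D R" using insert.prems(3) by (auto simp: disjoint_family_on_def)
    show "D r' \<subseteq> ?J \<and> card (D r') = d \<and> p r' ` D r' \<subseteq> S" if "r' \<in> R" for r'
      using insert.prems(4)[of r'] disj[OF that] that by auto
  qed (use insert.prems in auto)
  have inj: "inj_on ?F (avoiding I S (insert r R) D p)"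
  proof (rule inj_onI)
    fix c e assume ce: "c \<in> avoiding I S (insert r R) D p" "e \<in> avoiding I S (insert r R) D p" "?F c = ?F e"
    show "c = e"
    proof
      fix x
      have "restrict c ?J x = restrict e ?J x" "restrict c (D r) x = restrict e (D r) x"
        using ce(3) by auto
      moreover have "x \<notin> I \<Longrightarrow> c x = e x"
        using ce(1,2) by (auto simp: avoiding_def PiE_def extensional_def)
      ultimately show "c x = e x" by (auto split: if_splits)
    qed
  qed
  have "?F c \<in> avoiding ?J S R D p \<times> ?Q" if c: "c \<in> avoiding I S (insert r R) D p" for c
  proof -
    have "c \<in> I \<rightarrow>\<^sub>E S \<and> (\<forall>r'\<in>insert r R. \<exists>x\<in>D r'. c x \<noteq> p r' x)"
      using c unfolding avoiding_def by (rule CollectD)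
    then have cI: "c \<in> I \<rightarrow>\<^sub>E S"
      and av: "r' \<in> insert r R \<Longrightarrow> \<exists>x\<in>D r'. c x \<noteq> p r' x" for r'
      by (rule conjunct1, elim conjE bspec)
    have "\<exists>x\<in>D r'. restrict c ?J x \<noteq> p r' x" if r': "r' \<in> R" for r'
    proof -
      obtain x where x: "x \<in> D r'" "c x \<noteq> p r' x" using av[of r'] r' by blast
      then have "x \<in> ?J" using disj[OF that] insert.prems(4)[of r'] that by auto
      then show ?thesis using x by auto
    qed
    then have 1: "restrict c ?J \<in> avoiding ?J S R D p"
      using cI by (auto simp: avoiding_def)
    obtain x where "x \<in> D r" "c x \<noteq> p r x" using av[of r] by blast
    then have "restrict c (D r) \<noteq> restrict (p r) (D r)" by (metis restrict_apply')
    moreover have "restrict c (D r) \<in> D r \<rightarrow>\<^sub>E S" using cI r(1) by auto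
    ultimately show ?thesis using 1 by simp
  qed
  then have sub: "?F ` avoiding I S (insert r R) D p \<subseteq> avoiding ?J S R D p \<times> ?Q" by blast
  have "finite (avoiding ?J S R D p \<times> ?Q)"
    using insert.prems(1,2) finD by (simp add: finite_avoiding finite_PiE)
  then have "card (avoiding I S (insert r R) D p) \<le> card (avoiding ?J S R D p \<times> ?Q)"
    using card_inj_on_le[OF inj sub] by blast
  also have "\<dots> = card (avoiding ?J S R D p) * (?s ^ d - 1)"
  proof -
    \<comment> \<open>The excluded pattern takes its values in \<open>S\<close>, so exactly one of
      the patterns on \<open>D r\<close> is lost.\<close>
    have "restrict (p r) (D r) \<in> D r \<rightarrow>\<^sub>E S" using r(3) by auto
    then show ?thesis using finD r(2) insert.prems(1)
      by (simp add: card_cartesian_product card_Diff_singleton card_PiE)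
  qed
  finally have "card (avoiding I S (insert r R) D p) * (?s ^ d) ^ card (insert r R)
      \<le> (card (avoiding ?J S R D p) * (?s ^ d - 1)) * (?s ^ d) ^ card (insert r R)"
    by (rule mult_right_mono) simp
  also have "\<dots> = (card (avoiding ?J S R D p) * (?s ^ d) ^ card R) * ((?s ^ d - 1) * ?s ^ d)"
    using insert.hyps by simp
  also have "\<dots> \<le> (?s ^ card ?J * (?s ^ d - 1) ^ card R) * ((?s ^ d - 1) * ?s ^ d)"
    by (rule mult_right_mono[OF IH]) simp
  also have "\<dots> = (?s ^ card ?J * ?s ^ d) * (?s ^ d - 1) ^ card (insert r R)"
    using insert.hyps by simp
  also have "?s ^ card ?J * ?s ^ d = ?s ^ card I"
  proof -
    have "card ?J + d = card I"
      using r insert.prems(2) finD card_mono[of I "D r"] by (simp add: card_Diff_subset)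
    then show ?thesis by (metis power_add)
  qed
  finally show ?case .
qed

text \<open>The powers of \<open>q / (q - 1)\<close> are unbounded, so they exceed any constant
  \<open>C\<close>.\<close>

lemma exponential_decay:
  fixes q C :: nat
  assumes "q > 0"
  shows "\<exists>n. C * (q - 1) ^ n < q ^ n"
proof (cases "q = 1")
  case True
  \<comment> \<open>Here the quotient would divide by zero. The exponent is 1 because exponent 0
    would require \<open>C < 1\<close>.\<close>
  then have "C * (q - 1) ^ 1 < q ^ 1" by simp
  then show ?thesis by blast
next
  case False
  then have q: "real q / real (q - 1) > 1" "real (q - 1) > 0" using assms by auto
  obtain n where "real C < (real q / real (q - 1)) ^ n" using real_arch_pow[OF q(1)] by blast
  then have "real C * real (q - 1) ^ n < real q ^ n" using q(2)
    by (simp add: power_divide field_simps)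
  then have "C * (q - 1) ^ n < q ^ n"
    by (metis of_nat_less_iff of_nat_mult of_nat_power)
  then show ?thesis by blast
qed

section \<open>Many disjoint copies of a pattern of rules, obtained from recurrence\<close>

lemma recurrent_infinite:
  assumes "recurrent \<theta>" "finite D" "D \<noteq> {}"
  shows "infinite {r. \<forall>x\<in>D. \<theta> (x + r) = \<theta> x}" (is "infinite ?R")
proof
  assume fin: "finite ?R"
  \<comment> \<open>The union of all occurrences of the pattern is finite if \<open>?R\<close> is.
    Recurrence applied to this union gives a shift \<open>t\<close> that carries every occurrence to
    another one, so \<open>?R\<close> is closed under adding \<open>t\<close>.\<close>
  let ?E = "\<Union>r\<in>?R. (\<lambda>x. x + r) ` D"
  have "0 \<in> ?R" by simp
  then have "finite ?E" "?E \<noteq> {}" using fin assms by blast+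
  then obtain t where t: "t \<noteq> 0" "\<forall>x\<in>?E. \<theta> (x + t) = \<theta> x"
    using assms(1) unfolding recurrent_def by meson
  have "r + t \<in> ?R" if "r \<in> ?R" for r
  proof -
    have "\<theta> (x + (r + t)) = \<theta> x" if "x \<in> D" for x
    proof -
      have "x + r \<in> ?E" using \<open>r \<in> ?R\<close> that by blast
      then have "\<theta> (x + r + t) = \<theta> (x + r)" using t(2) by blast
      then show ?thesis using \<open>r \<in> ?R\<close> that by (simp add: add.assoc)
    qed
    then show ?thesis by simp
  qed
  \<comment> \<open>The sign of \<open>t\<close> is unknown: the maximum excludes a positive
    \<open>t\<close>, the minimum a negative one.\<close>
  then have "Max ?R + t \<in> ?R" "Min ?R + t \<in> ?R"
    using Max_in[OF fin] Min_in[OF fin] \<open>0 \<in> ?R\<close> by blast+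
  then have "Max ?R + t \<le> Max ?R" "Min ?R \<le> Min ?R + t"
    using Max_ge[OF fin] Min_le[OF fin] by blast+
  then show False using t(1) by simp
qed

text \<open>Greedy choice: the translates chosen so far rule out only the finitely many shifts of
  the form \<open>y + r - x\<close>, and an infinite \<open>T\<close> contains another one.\<close>

lemma disjoint_translates:
  fixes T :: "int set"
  assumes "infinite T" "finite D"
  shows "\<exists>R\<subseteq>T. finite R \<and> card R = n \<and> disjoint_family_on (\<lambda>r. (\<lambda>x. x + r) ` D) R"
proof (induction n)
  case 0
  show ?case by (rule exI[of _ "{}"]) (simp add: disjoint_family_on_def)
next
  case (Suc n)
  then obtain R where R: "R \<subseteq> T" "finite R" "card R = n"
      "disjoint_family_on (\<lambda>r. (\<lambda>x. x + r) ` D) R"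
    by blast
  let ?X = "(\<lambda>(x, y, r). y + r - x) ` (D \<times> D \<times> R)"
  have "finite (?X \<union> R)" using R(2) assms(2) by blast
  then obtain t where t: "t \<in> T" "t \<notin> ?X" "t \<notin> R"
    using assms(1) by (metis UnI1 UnI2 finite_subset subsetI)
  have "x + t \<noteq> y + r" if "x \<in> D" "y \<in> D" "r \<in> R" for x y r
  proof
    assume "x + t = y + r"
    then have "t = (\<lambda>(x, y, r). y + r - x) (x, y, r)" by simp
    then show False using t(2) that by blast
  qed
  then have "(\<lambda>x. x + t) ` D \<inter> (\<lambda>x. x + r) ` D = {}" if "r \<in> R" for r
    using that by blast
  then have "disjoint_family_on (\<lambda>r. (\<lambda>x. x + r) ` D) (insert t R)"
    using R(4) by (auto simp: disjoint_family_on_def)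
  then show ?case using R t by (intro exI[of _ "insert t R"]) auto
qed

text \<open>This is the counting contradiction for both implications: patterns on an interval
  widened by \<open>k\<close> at each end, once they avoid \<open>p\<close> on enough copies of
  \<open>D\<close>, are fewer than all patterns on the interval itself.\<close>

lemma few_avoiding:
  fixes \<theta> :: "int \<Rightarrow> 'r" and p :: "int \<Rightarrow> 's"
  assumes "recurrent \<theta>" "finite D" "D \<noteq> {}" "finite S" "S \<noteq> {}" "p ` D \<subseteq> S"
  obtains R A B where "finite R" "disjoint_family_on (\<lambda>r. (\<lambda>x. x + r) ` D) R"
    "\<And>r x. r \<in> R \<Longrightarrow> x \<in> D \<Longrightarrow> \<theta> (x + r) = \<theta> x"
    "\<And>r x. r \<in> R \<Longrightarrow> x \<in> D \<Longrightarrow> x + r \<in> {A..B}"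
    "card (avoiding {A - int k..B + int k} S R (\<lambda>r. (\<lambda>x. x + r) ` D) (\<lambda>r x. p (x - r)))
      < card ({A..B} \<rightarrow>\<^sub>E S)"
proof -
  let ?s = "card S"
  let ?q = "?s ^ card D"
  have s: "?s > 0" using assms by (simp add: card_gt_0_iff)
  \<comment> \<open>The factor \<open>?s ^ (2 * k)\<close> counts the patterns on the two margins.
    The number \<open>n\<close> of copies depends only on \<open>k\<close> and the cardinalities of
    \<open>S\<close> and \<open>D\<close>, so it is fixed before the interval, however far apart the
    copies lie.\<close>
  then obtain n where n: "?s ^ (2 * k) * (?q - 1) ^ n < ?q ^ n"
    using exponential_decay[of ?q "?s ^ (2 * k)"] by auto
  obtain R where R: "R \<subseteq> {r. \<forall>x\<in>D. \<theta> (x + r) = \<theta> x}" "finite R" "card R = n"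
      "disjoint_family_on (\<lambda>r. (\<lambda>x. x + r) ` D) R"
    using disjoint_translates[OF recurrent_infinite[OF assms(1-3)] assms(2)] by blast
  \<comment> \<open>Inserting 0 makes the minimum and maximum meaningful and gives
    \<open>A <= B\<close> without a check that \<open>R\<close> is nonempty.\<close>
  let ?E = "insert 0 ((\<lambda>(x, r). x + r) ` (D \<times> R))"
  define A B where "A = Min ?E" and "B = Max ?E"
  have finE: "finite ?E" using R(2) assms(2) by blast
  have in_AB: "x + r \<in> {A..B}" if "r \<in> R" "x \<in> D" for r x
  proof -
    have "x + r \<in> ?E" using that by auto
    then show ?thesis using finE unfolding A_def B_def by (simp del: insert_iff)
  qed
  have AB: "A \<le> B" using Min_le[OF finE, of 0] Max_ge[OF finE, of 0] unfolding A_def B_def by simp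
  let ?I = "{A - int k..B + int k}" and ?J = "{A..B}"
  let ?V = "avoiding ?I S R (\<lambda>r. (\<lambda>x. x + r) ` D) (\<lambda>r x. p (x - r))"
  have "card ?V * ?q ^ card R \<le> ?s ^ card ?I * (?q - 1) ^ card R"
  proof (rule card_avoiding_le[OF R(2) assms(4) _ R(4)])
    show "(\<lambda>x. x + r) ` D \<subseteq> ?I \<and> card ((\<lambda>x. x + r) ` D) = card D
        \<and> (\<lambda>x. p (x - r)) ` (\<lambda>x. x + r) ` D \<subseteq> S" if "r \<in> R" for r
      using in_AB[OF that] assms(6) by (fastforce simp: card_image)
  qed simp
  also have "?s ^ card ?I = ?s ^ card ?J * ?s ^ (2 * k)"
  proof -
    have "card ?I = card ?J + 2 * k" using AB by simp
    then show ?thesis by (simp only: power_add)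
  qed
  also have "\<dots> * (?q - 1) ^ card R < ?s ^ card ?J * ?q ^ card R"
    using n s R(3) by (simp add: mult.assoc)
  finally have "card ?V < ?s ^ card ?J" by simp
  then have "card ?V < card (?J \<rightarrow>\<^sub>E S)" by (simp add: card_PiE)
  with that[OF R(2,4)] R(1) in_AB show thesis by blast
qed

section \<open>Locality and compactness of the global update\<close>

lemma global_update_local:
  assumes "\<And>n. n \<in> set N \<Longrightarrow> c (x + n) = e (y + n)" "\<theta> x = \<theta> y"
  shows "global_update N \<theta> c x = global_update N \<theta> e y"
  using assms by (simp add: global_update_def cong: map_cong)

text \<open>A diagonal argument: nested infinite index sets \<open>M j\<close> are chosen so that
  the approximate preimages with index in \<open>M j\<close> agree on the window of radius
  \<open>j\<close>. Their limit is a preimage because each cell of the image depends on finitely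
  many cells.\<close>

lemma global_update_compact:
  assumes "finite \<Sigma>"
    and sol: "\<And>m. \<exists>e\<in>configurations \<Sigma>. \<forall>x\<in>{- int m..int m}. global_update N \<theta> e x = c x"
  shows "\<exists>e\<in>configurations \<Sigma>. global_update N \<theta> e = c"
proof -
  obtain e where e: "\<And>m. e m \<in> configurations \<Sigma>"
      "\<And>m x. x \<in> {- int m..int m} \<Longrightarrow> global_update N \<theta> (e m) x = c x"
    using sol by metis
  define hom where "hom j M \<longleftrightarrow> (\<forall>m\<in>M. \<forall>m'\<in>M. \<forall>x\<in>{- int j..int j}. e m x = e m' x)" for j M
  have refine: "\<exists>M'\<subseteq>M. infinite M' \<and> hom j M'" if inf: "infinite M" for M j
  proof -
    let ?f = "\<lambda>m. restrict (e m) {- int j..int j}"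
    have "?f ` M \<subseteq> {- int j..int j} \<rightarrow>\<^sub>E \<Sigma>"
      using e(1) by (auto simp: configurations_iff)
    then have "finite (?f ` M)"
      by (rule finite_subset) (simp add: finite_PiE assms(1))
    then obtain m0 where m0: "infinite {m \<in> M. ?f m = ?f m0}"
      using pigeonhole_infinite[OF inf] by blast
    have "e m x = e m' x" if "?f m = ?f m'" "x \<in> {- int j..int j}" for m m' x
      using fun_cong[OF that(1), of x] that(2) by simp
    then have "hom j {m \<in> M. ?f m = ?f m0}"
      unfolding hom_def by (metis (mono_tags, lifting) mem_Collect_eq)
    then show ?thesis using m0 by (intro exI[of _ "{m \<in> M. ?f m = ?f m0}"]) simp
  qed
  have "\<exists>M. \<forall>j. (infinite (M j) \<and> hom j (M j)) \<and> M (Suc j) \<subseteq> M j"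
  proof (rule dependent_nat_choice)
    show "\<exists>M. infinite M \<and> hom 0 M" using refine[of UNIV 0] by auto
    show "\<exists>M'. (infinite M' \<and> hom (Suc j) M') \<and> M' \<subseteq> M" if "infinite M \<and> hom j M" for M j
      using refine[of M "Suc j"] that by blast
  qed
  then obtain M where M: "\<And>j. infinite (M j)" "\<And>j. hom j (M j)" "\<And>j. M (Suc j) \<subseteq> M j"
    by blast
  have mono: "M j \<subseteq> M i" if "i \<le> j" for i j
    using lift_Suc_antimono_le[of M, OF M(3) that] .
  \<comment> \<open>Any index in the set will do, since all approximations indexed by it agree at
    \<open>x\<close>.\<close>
  define g where "g x = e (SOME m. m \<in> M (nat \<bar>x\<bar>)) x" for x
  have g: "g x = e m x" if "m \<in> M j" "nat \<bar>x\<bar> \<le> j" for x m j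
  proof -
    have "(SOME m. m \<in> M (nat \<bar>x\<bar>)) \<in> M (nat \<bar>x\<bar>)"
      using M(1) by (metis finite.emptyI ex_in_conv someI_ex)
    moreover have "m \<in> M (nat \<bar>x\<bar>)" using mono[OF that(2)] that(1) by blast
    moreover have "x \<in> {- int (nat \<bar>x\<bar>)..int (nat \<bar>x\<bar>)}" by auto
    ultimately show ?thesis using M(2) unfolding g_def hom_def by blast
  qed
  have "global_update N \<theta> g x = c x" for x
  proof -
    \<comment> \<open>The window of radius \<open>j\<close> contains all neighbours of
      \<open>x\<close>. The index \<open>m\<close> must lie in \<open>M j\<close>, so that
      \<open>e m\<close> agrees with \<open>g\<close> on them, and be at least the absolute value of
      \<open>x\<close>, so that the image of \<open>e m\<close> is correct at
      \<open>x\<close>.\<close>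
    define j where "j = Max (insert 0 ((\<lambda>n. nat \<bar>x + n\<bar>) ` set N))"
    obtain m where m: "m \<in> M j" "m \<ge> nat \<bar>x\<bar>"
      using M(1) by (meson infinite_nat_iff_unbounded_le)
    have "g (x + n) = e m (x + n)" if "n \<in> set N" for n
      using that by (intro g[OF m(1)]) (simp add: j_def)
    then have "global_update N \<theta> g x = global_update N \<theta> (e m) x"
      by (intro global_update_local) auto
    also have "\<dots> = c x" using m(2) by (intro e(2)) auto
    finally show ?thesis .
  qed
  moreover have "g \<in> configurations \<Sigma>"
    using e(1) by (auto simp: configurations_iff g_def)
  ultimately show ?thesis by blast
qed

section \<open>The two implications\<close>

lemma neighbourhood_radius:
  fixes N :: neighbourhood
  obtains k :: nat where "\<And>n. n \<in> set N \<Longrightarrow> \<bar>n\<bar> \<le> int k"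
proof
  show "\<bar>n\<bar> \<le> int (Max (insert 0 ((\<lambda>n. nat \<bar>n\<bar>) ` set N)))" if "n \<in> set N" for n
  proof -
    have "nat \<bar>n\<bar> \<le> Max (insert 0 ((\<lambda>n. nat \<bar>n\<bar>) ` set N))" using that by simp
    then show ?thesis by linarith
  qed
qed

text \<open>Copies of the pattern of \<open>c\<close> are overwritten by that of \<open>e\<close>,
  one at a time. A cell that sees a change has its whole neighbourhood inside the translate of
  \<open>D\<close> and carries the same rule as the corresponding cell of the original, so the
  equality of the images of \<open>c\<close> and \<open>e\<close> carries over. All other cells see
  no change.\<close>

lemma erase_pattern:
  assumes k: "\<And>n. n \<in> set N \<Longrightarrow> \<bar>n\<bar> \<le> int k"
    and ce: "c \<noteq> e" "e \<in> configurations \<Sigma>" "global_update N \<theta> c = global_update N \<theta> e"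
    and D: "\<And>x y. c x \<noteq> e x \<Longrightarrow> \<bar>y - x\<bar> \<le> 2 * int k \<Longrightarrow> y \<in> D"
    and R: "finite R" "disjoint_family_on (\<lambda>r. (\<lambda>x. x + r) ` D) R"
      "\<And>r x. r \<in> R \<Longrightarrow> x \<in> D \<Longrightarrow> \<theta> (x + r) = \<theta> x"
    and f: "f \<in> configurations \<Sigma>"
  shows "\<exists>g\<in>configurations \<Sigma>. global_update N \<theta> g = global_update N \<theta> f
    \<and> (\<forall>r\<in>R. \<exists>x\<in>D. g (x + r) \<noteq> c x)"
  using R
proof (induction R rule: finite_induct)
  case empty
  then show ?case using f by blast
next
  case (insert r R)
  have "disjoint_family_on (\<lambda>r. (\<lambda>x. x + r) ` D) R"
    using insert.prems(1) by (auto simp: disjoint_family_on_def)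
  then obtain g where g: "g \<in> configurations \<Sigma>" "global_update N \<theta> g = global_update N \<theta> f"
      "\<forall>r\<in>R. \<exists>x\<in>D. g (x + r) \<noteq> c x"
    using insert.IH insert.prems(2) by blast
  show ?case
  proof (cases "\<exists>x\<in>D. g (x + r) \<noteq> c x")
    case True
    then show ?thesis using g by blast
  next
    case False
    then have eq: "g y = c (y - r)" if "y - r \<in> D" for y using that by force
    \<comment> \<open>The whole translate is overwritten, yet \<open>h\<close> differs from
      \<open>g\<close> only at translates of cells where \<open>c\<close> and \<open>e\<close>
      differ, because \<open>g\<close> shows \<open>c\<close> there.\<close>
    define h where "h y = (if y - r \<in> D then e (y - r) else g y)" for y
    have h_e: "h y = e (y - r)" if "y - r \<in> D" for y using that by (simp add: h_def)
    have h_g: "h y = g y" if "c (y - r) = e (y - r)" for y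
      using that eq by (auto simp: h_def)
    obtain x0 where x0: "c x0 \<noteq> e x0" using ce(1) by blast
    have "global_update N \<theta> h y = global_update N \<theta> g y" for y
    proof (cases "\<exists>n\<in>set N. c (y + n - r) \<noteq> e (y + n - r)")
      case True
      then obtain n where n: "n \<in> set N" "c (y + n - r) \<noteq> e (y + n - r)" by blast
      \<comment> \<open>Two steps of length at most \<open>k\<close> lead from the differing cell to
        any such cell, hence the margin \<open>2 * k\<close> around the differences. The case
        \<open>m = 0\<close> puts \<open>y - r\<close> itself in \<open>D\<close>, where the rules
        are known to agree.\<close>
      have near: "y - r + m \<in> D" if "\<bar>m\<bar> \<le> int k" for m
      proof (rule D[OF n(2)])
        show "\<bar>y - r + m - (y + n - r)\<bar> \<le> 2 * int k" using k[OF n(1)] that by linarith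
      qed
      have th: "\<theta> y = \<theta> (y - r)"
        using insert.prems(2)[of r "y - r"] near[of 0] by simp
      have near': "y + m - r \<in> D" if "m \<in> set N" for m
        using near[OF k[OF that]] by (simp add: algebra_simps)
      have "global_update N \<theta> h y = global_update N \<theta> e (y - r)"
        using h_e[OF near'] th by (intro global_update_local) (simp_all add: algebra_simps)
      also have "\<dots> = global_update N \<theta> c (y - r)" using ce(3) by simp
      also have "\<dots> = global_update N \<theta> g y"
        using eq[OF near'] th by (intro global_update_local) (simp_all add: algebra_simps)
      finally show ?thesis .
    next
      case False
      then show ?thesis by (intro global_update_local) (auto intro: h_g)
    qed
    then have "global_update N \<theta> h = global_update N \<theta> f" using g(2) by auto
    moreover have "h \<in> configurations \<Sigma>"
      using g(1) ce(2) by (auto simp: configurations_iff h_def)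
    moreover have "\<exists>x\<in>D. h (x + r') \<noteq> c x" if r': "r' \<in> insert r R" for r'
    proof (cases "r' = r")
      case True
      have "x0 \<in> D" using D[OF x0, of x0] by simp
      then show ?thesis using x0 h_e[of "x0 + r"] True by (intro bexI[of _ x0]) auto
    next
      case False
      then have "r' \<in> R" using r' by simp
      then obtain x where x: "x \<in> D" "g (x + r') \<noteq> c x" using g(3) by blast
      \<comment> \<open>By disjointness the cell that witnesses avoidance on an earlier copy is not
        overwritten.\<close>
      have "x + r' - r \<notin> D"
      proof
        assume "x + r' - r \<in> D"
        then have "x + r' \<in> (\<lambda>x. x + r) ` D" by (intro image_eqI[of _ _ "x + r' - r"]) auto
        moreover have "x + r' \<in> (\<lambda>x. x + r') ` D" using x(1) by blast
        ultimately show False using insert.prems(1) \<open>r' \<in> R\<close> False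
          by (auto simp: disjoint_family_on_def)
      qed
      then show ?thesis using x by (auto simp: h_def)
    qed
    ultimately show ?thesis by blast
  qed
qed

text \<open>If \<open>c\<close> and \<open>e\<close> violate pre-injectivity, every pattern on
  \<open>{A..B}\<close> has a preimage that avoids \<open>c\<close> on all copies of
  \<open>D\<close>. The avoiding patterns on the widened interval then map onto all patterns on
  \<open>{A..B}\<close>, although they are fewer.\<close>

lemma surjective_imp_pre_injective:
  assumes fin: "finite \<Sigma>" and rec: "recurrent \<theta>"
    and surj: "configurations \<Sigma> \<subseteq> global_update N \<theta> ` configurations \<Sigma>"
  shows "pre_injective_on (configurations \<Sigma>) (global_update N \<theta>)"
proof -
  have False if ce: "c \<in> configurations \<Sigma>" "e \<in> configurations \<Sigma>" "asymptotic c e" "c \<noteq> e"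
      "global_update N \<theta> c = global_update N \<theta> e" for c e
  proof -
    obtain k :: nat where k: "\<And>n. n \<in> set N \<Longrightarrow> \<bar>n\<bar> \<le> int k"
      using neighbourhood_radius[of N] by blast
    define D where "D = (\<Union>x\<in>{x. c x \<noteq> e x}. {x - 2 * int k..x + 2 * int k})"
    obtain x0 where "c x0 \<noteq> e x0" using ce(4) by blast
    then have "x0 \<in> D" unfolding D_def by force
    then have D: "finite D" "D \<noteq> {}" using ce(3) by (auto simp: D_def asymptotic_def)
    have S: "\<Sigma> \<noteq> {}" "c ` D \<subseteq> \<Sigma>" using ce(1) by (auto simp: configurations_iff)
    obtain R A B where R: "finite R" "disjoint_family_on (\<lambda>r. (\<lambda>x. x + r) ` D) R"
        "\<And>r x. r \<in> R \<Longrightarrow> x \<in> D \<Longrightarrow> \<theta> (x + r) = \<theta> x"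
        "\<And>r x. r \<in> R \<Longrightarrow> x \<in> D \<Longrightarrow> x + r \<in> {A..B}"
        "card (avoiding {A - int k..B + int k} \<Sigma> R (\<lambda>r. (\<lambda>x. x + r) ` D) (\<lambda>r x. c (x - r)))
          < card ({A..B} \<rightarrow>\<^sub>E \<Sigma>)"
      by (rule few_avoiding[OF rec D fin S, where k = k]) auto
    let ?I = "{A - int k..B + int k}" and ?J = "{A..B}"
    let ?V = "avoiding ?I \<Sigma> R (\<lambda>r. (\<lambda>x. x + r) ` D) (\<lambda>r x. c (x - r))"
    let ?F = "\<lambda>g. restrict (global_update N \<theta> g) ?J"
    have "t \<in> ?F ` ?V" if t: "t \<in> ?J \<rightarrow>\<^sub>E \<Sigma>" for t
    proof -
      \<comment> \<open>The values of \<open>c\<close> serve only to extend \<open>t\<close> to a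
        configuration.\<close>
      define t' where "t' x = (if x \<in> ?J then t x else c x)" for x
      have "t' \<in> configurations \<Sigma>" using t ce(1) by (auto simp: t'_def configurations_iff)
      then obtain f where f: "f \<in> configurations \<Sigma>" "global_update N \<theta> f = t'" using surj by blast
      have "y \<in> D" if "c x \<noteq> e x" "\<bar>y - x\<bar> \<le> 2 * int k" for x y
        using that unfolding D_def by (intro UN_I[of x]) auto
      then obtain g where g: "g \<in> configurations \<Sigma>" "global_update N \<theta> g = global_update N \<theta> f"
          "\<forall>r\<in>R. \<exists>x\<in>D. g (x + r) \<noteq> c x"
        using erase_pattern[OF k ce(4,2,5) _ R(1-3) f(1)] by metis
      have "global_update N \<theta> (restrict g ?I) x = t x" if "x \<in> ?J" for x
      proof -
        \<comment> \<open>Cells of \<open>?J\<close> look at most \<open>k\<close> away, so they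
          never see the default value of the restriction outside \<open>?I\<close>.\<close>
        have "global_update N \<theta> (restrict g ?I) x = global_update N \<theta> g x"
          using that by (intro global_update_local) (auto dest!: k)
        then show ?thesis using g(2) f(2) that by (simp add: t'_def)
      qed
      then have "?F (restrict g ?I) = t"
        using t by (intro ext) (auto simp: PiE_def extensional_def)
      moreover have "restrict g ?I \<in> ?V"
      proof -
        have "\<exists>x\<in>(\<lambda>x. x + r) ` D. restrict g ?I x \<noteq> c (x - r)" if r: "r \<in> R" for r
        proof -
          obtain x where "x \<in> D" "g (x + r) \<noteq> c x" using g(3) r by blast
          then show ?thesis using R(4)[OF r, of x] by (intro bexI[of _ "x + r"]) auto
        qed
        then show ?thesis using g(1) by (auto simp: avoiding_def configurations_iff)
      qed
      ultimately show ?thesis by blast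
    qed
    then have "card (?J \<rightarrow>\<^sub>E \<Sigma>) \<le> card ?V"
      by (intro surj_card_le[of _ _ ?F] finite_avoiding) (use fin in auto)
    then show False using R(5) by linarith
  qed
  then show ?thesis unfolding pre_injective_on_def by blast
qed

text \<open>By compactness, a configuration \<open>c\<close> without preimage is already missed on a
  finite window, hence every image avoids the pattern of \<open>c\<close> on each copy of the window
  that carries the same rules. Pre-injectivity would embed all patterns on \<open>{A..B}\<close>
  into the smaller set of avoiding patterns on the widened interval.\<close>

lemma pre_injective_imp_surjective:
  assumes fin: "finite \<Sigma>" and rec: "recurrent \<theta>"
    and closed: "\<And>c. c \<in> configurations \<Sigma> \<Longrightarrow> global_update N \<theta> c \<in> configurations \<Sigma>"
    and preinj: "pre_injective_on (configurations \<Sigma>) (global_update N \<theta>)"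
  shows "configurations \<Sigma> \<subseteq> global_update N \<theta> ` configurations \<Sigma>"
proof (rule ccontr)
  assume "\<not> ?thesis"
  then obtain c where c: "c \<in> configurations \<Sigma>" "c \<notin> global_update N \<theta> ` configurations \<Sigma>" by blast
  obtain m where m: "\<And>e. e \<in> configurations \<Sigma> \<Longrightarrow>
      \<exists>x\<in>{- int m..int m}. global_update N \<theta> e x \<noteq> c x"
    using global_update_compact[OF fin, of N \<theta> c] c(2) by blast
  let ?D = "{- int m..int m}"
  obtain k :: nat where k: "\<And>n. n \<in> set N \<Longrightarrow> \<bar>n\<bar> \<le> int k"
    using neighbourhood_radius[of N] by blast
  have S: "\<Sigma> \<noteq> {}" "c ` ?D \<subseteq> \<Sigma>" using c(1) by (auto simp: configurations_iff)
  obtain R A B where R: "finite R" "disjoint_family_on (\<lambda>r. (\<lambda>x. x + r) ` ?D) R"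
      "\<And>r x. r \<in> R \<Longrightarrow> x \<in> ?D \<Longrightarrow> \<theta> (x + r) = \<theta> x"
      "\<And>r x. r \<in> R \<Longrightarrow> x \<in> ?D \<Longrightarrow> x + r \<in> {A..B}"
      "card (avoiding {A - int k..B + int k} \<Sigma> R (\<lambda>r. (\<lambda>x. x + r) ` ?D) (\<lambda>r x. c (x - r)))
        < card ({A..B} \<rightarrow>\<^sub>E \<Sigma>)"
    by (rule few_avoiding[OF rec _ _ fin S, where k = k]) auto
  let ?I = "{A - int k..B + int k}" and ?J = "{A..B}"
  let ?V = "avoiding ?I \<Sigma> R (\<lambda>r. (\<lambda>x. x + r) ` ?D) (\<lambda>r x. c (x - r))"
  \<comment> \<open>A common exterior makes all these extensions asymptotic to one another.\<close>
  define E where "E t x = (if x \<in> ?J then t x else c x)" for t x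
  let ?F = "\<lambda>t. restrict (global_update N \<theta> (E t)) ?I"
  have E: "E t \<in> configurations \<Sigma>" if "t \<in> ?J \<rightarrow>\<^sub>E \<Sigma>" for t
    using that c(1) by (auto simp: E_def configurations_iff)
  have "?F t \<in> ?V" if t: "t \<in> ?J \<rightarrow>\<^sub>E \<Sigma>" for t
  proof -
    have "\<exists>x\<in>(\<lambda>x. x + r) ` ?D. ?F t x \<noteq> c (x - r)" if r: "r \<in> R" for r
    proof -
      \<comment> \<open>Shifting back by \<open>r\<close> moves the copy onto the original window,
        where no image can agree with \<open>c\<close>.\<close>
      have "(\<lambda>x. E t (x + r)) \<in> configurations \<Sigma>" using E[OF t] by (auto simp: configurations_iff)
      then obtain x where x: "x \<in> ?D" "global_update N \<theta> (\<lambda>x. E t (x + r)) x \<noteq> c x" using m by blast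
      have "global_update N \<theta> (\<lambda>x. E t (x + r)) x = global_update N \<theta> (E t) (x + r)"
        using R(3)[OF r x(1)] by (intro global_update_local) (auto simp: algebra_simps)
      then show ?thesis using x R(4)[OF r x(1)] by (intro bexI[of _ "x + r"]) auto
    qed
    then show ?thesis using closed[OF E[OF t]] by (auto simp: avoiding_def configurations_iff)
  qed
  moreover have "inj_on ?F (?J \<rightarrow>\<^sub>E \<Sigma>)"
  proof (rule inj_onI)
    fix t u assume tu: "t \<in> ?J \<rightarrow>\<^sub>E \<Sigma>" "u \<in> ?J \<rightarrow>\<^sub>E \<Sigma>" "?F t = ?F u"
    have "global_update N \<theta> (E t) x = global_update N \<theta> (E u) x" for x
    proof (cases "x \<in> ?I")
      case True
      then show ?thesis using fun_cong[OF tu(3), of x] by simp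
    next
      case False
      \<comment> \<open>All neighbours of a cell outside \<open>?I\<close> lie outside
        \<open>?J\<close>, where \<open>E t\<close> and \<open>E u\<close> both equal
        \<open>c\<close>. Equality of the images on \<open>?I\<close> thus extends to the whole
        line.\<close>
      then show ?thesis by (intro global_update_local) (auto simp: E_def dest!: k)
    qed
    then have "global_update N \<theta> (E t) = global_update N \<theta> (E u)" by blast
    moreover have "asymptotic (E t) (E u)"
      unfolding asymptotic_def by (rule finite_subset[of _ ?J]) (auto simp: E_def)
    ultimately have "E t = E u"
      using preinj E[OF tu(1)] E[OF tu(2)] unfolding pre_injective_on_def by blast
    then have "t x = u x" if "x \<in> ?J" for x
      using that by (metis E_def)
    then show "t = u" using tu(1,2) by (metis PiE_ext)
  qed
  ultimately have "card (?J \<rightarrow>\<^sub>E \<Sigma>) \<le> card ?V"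
    by (intro card_inj_on_le[of ?F] finite_avoiding) (use fin in auto)
  then show False using R(5) by linarith
qed

theorem theorem2:
  fixes \<Sigma> :: "'a set" and N :: neighbourhood
    and \<R> :: "('a list \<Rightarrow> 'a) set" and \<theta> :: "int \<Rightarrow> 'a list \<Rightarrow> 'a"
  assumes "finite \<Sigma>"
    and "finite \<R>" and "\<R> \<subseteq> local_rules \<Sigma> N"
    and "\<theta> \<in> configurations \<R>" and "recurrent \<theta>"
  shows "global_update N \<theta> ` configurations \<Sigma> = configurations \<Sigma> \<longleftrightarrow>
    pre_injective_on (configurations \<Sigma>) (global_update N \<theta>)"
proof -
  have "global_update N \<theta> c \<in> configurations \<Sigma>" if "c \<in> configurations \<Sigma>" for c
    using global_update_configurations[OF assms(3,4) that] .
  then show ?thesis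
    using surjective_imp_pre_injective[OF assms(1,5)] pre_injective_imp_surjective[OF assms(1,5)]
    by (metis image_subsetI order_antisym order_refl)
qed

end
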